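(* Let $G$ be a finite simple graph on at least $3$ vertices. If $G$ is $3$-tough and $(K_2 \cup 3K_1)$-free, then $G$ is hamiltonian.
   Context: For a graph $G$, $c(G)$ denotes the number of connected components of $G$. A cut set of $G$ is a set $S \subseteq V(G)$ such that $G-S$ is disconnected. For a real number $t \ge 0$, $G$ is $t$-tough if $t\cdot c(G-S) \le |S|$ for every cut set $S$ of $G$. $G$ is hamiltonian if it has a cycle containing every vertex. $G$ is $H$-free if it contains no induced subgraph isomorphic to $H$. $K_2 \cup 3K_1$ denotes the disjoint union of an edge and three isolated vertices (a graph on 5 vertices with exactly one edge). *)

theory Defs
  imports Complex_Main "Graph_Theory.Graph_Theory"
begin

text \<open>
  Finite simple graphs are the locale \<^locale>\<open>graph\<close>: finite digraphs without loops and
  parallel arcs whose arc relation is symmetric. An edge is thus a pair of opposite arcs.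
\<close>

definition components :: "('a,'b) pre_digraph \<Rightarrow> ('a,'b) pre_digraph set" where
  "components G = {H. pre_digraph.max_subgraph G Digraph_Component.connected H}"

definition num_components :: "('a,'b) pre_digraph \<Rightarrow> nat" where
  "num_components G = card (components G)"

definition del_verts :: "('a,'b) pre_digraph \<Rightarrow> 'a set \<Rightarrow> ('a,'b) pre_digraph" where
  "del_verts G S = G \<restriction> (verts G - S)"

text \<open>
  The graph without vertices is not \<^const>\<open>Digraph_Component.connected\<close>, so \<^term>\<open>verts G\<close> itself
  is formally a cut set. It imposes no condition in \<open>tough\<close>, as the empty graph has no components.
\<close>

definition cut_set :: "('a,'b) pre_digraph \<Rightarrow> 'a set \<Rightarrow> bool" where
  "cut_set G S \<longleftrightarrow> S \<subseteq> verts G \<and> \<not> Digraph_Component.connected (del_verts G S)"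

definition tough :: "real \<Rightarrow> ('a,'b) pre_digraph \<Rightarrow> bool" where
  "tough t G \<longleftrightarrow>
    (\<forall>S. cut_set G S \<longrightarrow> t * real (num_components (del_verts G S)) \<le> real (card S))"

text \<open>
  In a symmetric digraph an arc followed by its reverse is a \<^const>\<open>pre_digraph.cycle\<close>; the bound on
  the length excludes these. The vertices of a closed walk are the tails of its arcs.
\<close>

definition hamiltonian :: "('a,'b) pre_digraph \<Rightarrow> bool" where
  "hamiltonian G \<longleftrightarrow>
    (\<exists>p. pre_digraph.cycle G p \<and> 3 \<le> length p \<and> verts G \<subseteq> tail G ` set p)"

definition induced_free :: "('c,'d) pre_digraph \<Rightarrow> ('a,'b) pre_digraph \<Rightarrow> bool" where
  "induced_free H G \<longleftrightarrow> \<not> (\<exists>H'. induced_subgraph H' G \<and> digraph_iso H' H)"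

definition K2_3K1 :: "(nat, nat \<times> nat) pre_digraph" where
  "K2_3K1 = with_proj \<lparr> pverts = {0, 1, 2, 3, 4}, parcs = {(0, 1), (1, 0)} \<rparr>"

lemma graph_K2_3K1: "graph K2_3K1"
proof -
  interpret pair_graph "\<lparr> pverts = {0, 1, 2, 3, 4}, parcs = {(0, 1), (1, 0)} \<rparr> :: nat pair_pre_digraph"
    by unfold_locales (auto simp: symmetric_def intro: symI)
  show ?thesis
    unfolding K2_3K1_def by unfold_locales
qed

lemma (in wf_digraph) strongly_connected_imp_connected:
  assumes "strongly_connected G"
  shows "Digraph_Component.connected G"
proof -
  have "u \<rightarrow>\<^sup>*\<^bsub>with_proj (mk_symmetric G)\<^esub> v" if "u \<rightarrow>\<^sup>* v" for u v
    using that by (rule reachable_mk_symmetricI)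
  with assms show ?thesis
    by (auto simp: Digraph_Component.connected_def strongly_connected_def)
qed

lemma (in graph) components_eq_sccs: "components G = sccs"
proof -
  have sc: "strongly_connected (G \<restriction> verts H)"
    if H: "subgraph H G" "Digraph_Component.connected H" for H
  proof -
    interpret I: wf_digraph "G \<restriction> verts H" by (rule wellformed_induce_subgraph)
    have "spanning H (G \<restriction> verts H)"
      using H by (auto simp: spanning_def intro: subgraph_induce_subgraphI2)
    then have "Digraph_Component.connected (G \<restriction> verts H)"
      using H(2) by (rule I.connected_spanning_imp_connected)
    moreover have "symmetric (G \<restriction> verts H)"
      using sym_arcs by (rule induced_graph_imp_symmetric) (use H in auto)
    ultimately show ?thesis by (intro I.symmetric_connected_imp_strongly_connected)
  qed
  have conn: "Digraph_Component.connected H" if "subgraph H G" "strongly_connected H" for H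
    using that by (meson subgraphE wf_digraph.strongly_connected_imp_connected)
  have ind: "induced_subgraph (G \<restriction> verts H) G" "subgraph H (G \<restriction> verts H)"
    if "subgraph H G" for H
    using that by (auto intro: subgraph_induce_subgraphI2)
  show ?thesis
  proof (intro equalityI subsetI)
    fix H assume "H \<in> components G"
    then have H: "subgraph H G" "Digraph_Component.connected H"
      and max: "\<And>H'. subgraph H H' \<Longrightarrow> subgraph H' G \<Longrightarrow> Digraph_Component.connected H' \<Longrightarrow> H' = H"
      by (auto simp: components_def max_subgraph_def)
    have eq: "G \<restriction> verts H = H"
      by (intro max ind(2) H conn sc induced_imp_subgraph[OF ind(1)])
    have "\<not> verts H \<subset> verts H'" if H': "induced_subgraph H' G" "strongly_connected H'" for H'
    proof
      assume less: "verts H \<subset> verts H'"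
      have "subgraph (G \<restriction> verts H) H'"
      proof (rule subgraphI)
        show "arcs (G \<restriction> verts H) \<subseteq> arcs H'"
          using H'(1) less by (auto simp: induced_subgraph_def)
        show "compatible H' (G \<restriction> verts H)"
          using H'(1) by (simp add: induced_subgraph_def subgraph_def compatible_def)
      qed (use less H'(1) in \<open>auto intro: wf_digraphI_induced\<close>)
      then have "H' = H"
        using max[of H'] H' conn eq by (simp add: induced_subgraph_def)
      with less show False by simp
    qed
    moreover have "induced_subgraph H G" "strongly_connected H"
      using ind(1)[OF H(1)] sc[OF H] eq by simp_all
    ultimately show "H \<in> sccs" unfolding sccs_def by blast
  next
    fix H assume "H \<in> sccs"
    then have H: "induced_subgraph H G" "strongly_connected H"
      and max: "\<And>H'. induced_subgraph H' G \<Longrightarrow> strongly_connected H' \<Longrightarrow> \<not> verts H \<subset> verts H'"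
      by (auto simp: sccs_def)
    have "H' = H" if H': "subgraph H H'" "subgraph H' G" "Digraph_Component.connected H'" for H'
    proof -
      have "verts H = verts H'"
        using max[OF ind(1)[OF H'(2)] sc[OF H'(2,3)]] H'(1) by (auto simp: subgraph_def)
      moreover have "arcs H \<subseteq> arcs H'" "arcs H' \<subseteq> arcs G"
        using H' by (simp_all add: subgraph_def)
      moreover have "arcs H' \<subseteq> arcs (G \<restriction> verts H')"
        using ind(2)[OF H'(2)] by (simp add: subgraph_def)
      ultimately have "arcs H' = {e \<in> arcs G. tail G e \<in> verts H' \<and> head G e \<in> verts H'}"
        using H(1) by (auto simp: induced_subgraph_def)
      with H'(2) have "induced_subgraph H' G" by (rule induced_subgraphI)
      with H(1) \<open>verts H = verts H'\<close> show ?thesis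
        using induced_eq_verts_imp_eq by metis
    qed
    moreover have "subgraph H G" using H(1) by (rule induced_imp_subgraph)
    ultimately show "H \<in> components G"
      using conn H(2) unfolding components_def max_subgraph_def by blast
  qed
qed

end

theory Submission
  imports Defs
begin

text \<open>
  Let \<open>C\<close> be a longest cycle. A component \<open>K\<close> of \<open>G - C\<close> has at least six neighbours on \<open>C\<close> by
  3-toughness, and their successors on \<open>C\<close> form an independent set with no neighbour in \<open>K\<close>, so
  an edge inside \<open>K\<close> would give an induced \<open>K\<^sub>2 \<union> 3K\<^sub>1\<close>. Hence the vertices off \<open>C\<close> are independent.
  For such a vertex \<open>h\<close>, let \<open>J\<close> consist of \<open>h\<close> and the successors of its neighbours, and let \<open>D\<close>
  be the set of vertices with a neighbour in \<open>J\<close>. By \<open>K\<^sub>2 \<union> 3K\<^sub>1\<close>-freeness a vertex of \<open>D\<close> misses at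
  most two vertices of \<open>J\<close>, while \<open>V - D\<close> is independent. If two consecutive vertices of \<open>C\<close> were in
  \<open>D\<close>, then, as \<open>h\<close> has at least six neighbours, one could reroute \<open>C\<close> through \<open>h\<close> along two crossing
  chords; similarly \<open>D\<close> lies on \<open>C\<close>. So \<open>|D| < |V - D|\<close>, and deleting \<open>D\<close> contradicts
  toughness.
\<close>

section \<open>Detours around a longest cycle\<close>

text \<open>The combinatorial argument concerns only vertices and adjacency, so it runs on a bare
  symmetric relation; arcs return in the transfer to digraphs.\<close>

locale finite_adjacency =
  fixes V :: "'a set" and E :: "'a \<Rightarrow> 'a \<Rightarrow> bool"
  assumes finite_V: "finite V"
    and adj_sym: "E u v \<Longrightarrow> E v u"
    and adj_irrefl: "\<not> E u u"
    and adj_in_V: "E u v \<Longrightarrow> u \<in> V"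
begin

lemma adj_in_V2: "E u v \<Longrightarrow> v \<in> V"
  using adj_sym adj_in_V by blast

definition nbrs :: "'a set \<Rightarrow> 'a set" where
  "nbrs K = {v \<in> V - K. \<exists>k\<in>K. E k v}"

lemma nbrs_subset_V: "nbrs K \<subseteq> V"
  by (auto simp: nbrs_def)

text \<open>A single edge traversed back and forth counts as a cycle of length two.\<close>

definition cyc :: "'a list \<Rightarrow> bool" where
  "cyc xs \<longleftrightarrow> xs \<noteq> [] \<and> distinct xs \<and> set xs \<subseteq> V \<and> successively E xs \<and> E (last xs) (hd xs)"

text \<open>Simplifying \<open>successively E (rev xs)\<close> flips the relation; this rule flips
  it back, so that cycles can be built from reversed segments.\<close>

lemma successively_adj_flip [simp]: "successively (\<lambda>x y. E y x) xs \<longleftrightarrow> successively E xs"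
  by (induction xs rule: induct_list012) (auto intro: adj_sym)

lemma cyc_append_commute: "cyc (xs @ ys) \<Longrightarrow> cyc (ys @ xs)"
  by (cases "xs = []"; cases "ys = []") (auto simp: cyc_def successively_append_iff)

lemma cyc_rotate: "cyc xs \<Longrightarrow> cyc (rotate k xs)"
  by (metis append_take_drop_id cyc_append_commute rotate_drop_take)

lemma length_cyc_le: "cyc xs \<Longrightarrow> length xs \<le> card V"
  by (metis cyc_def card_mono distinct_card finite_V)

lemma obtain_path_inside:
  assumes "(u, v) \<in> {(x, y). E x y \<and> x \<in> W \<and> y \<in> W}\<^sup>*" "u \<in> W"
  obtains hs where "hs \<noteq> []" "distinct hs" "set hs \<subseteq> W" "successively E hs" "hd hs = u" "last hs = v"
proof -
  have "\<exists>hs. hs \<noteq> [] \<and> distinct hs \<and> set hs \<subseteq> W \<and> successively E hs \<and> hd hs = u \<and> last hs = v"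
    using assms(1)
  proof (induction rule: rtrancl_induct)
    case base
    show ?case by (rule exI[of _ "[u]"]) (simp add: assms)
  next
    case (step y z)
    then obtain hs where hs: "hs \<noteq> []" "distinct hs" "set hs \<subseteq> W" "successively E hs" "hd hs = u" "last hs = y"
      by blast
    show ?case
    proof (cases "z \<in> set hs")
      \<comment> \<open>A repetition is avoided by cutting the path back to its earlier visit to
        \<open>z\<close>.\<close>
      case True
      then obtain as bs where "hs = as @ z # bs" by (meson split_list)
      with hs show ?thesis
        by (intro exI[of _ "as @ [z]"]) (auto simp: successively_append_iff hd_append)
    next
      case False
      with hs step show ?thesis
        by (intro exI[of _ "hs @ [z]"]) (auto simp: successively_append_iff)
    qed
  qed
  with that show ?thesis by blast
qed

end

locale longest_cycle = finite_adjacency +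
  fixes xs :: "'a list"
  assumes cyc_xs: "cyc xs"
    and longest: "cyc ys \<Longrightarrow> length ys \<le> length xs"
begin

section \<open>The successor map of a longest cycle\<close>

abbreviation C :: "'a set" where "C \<equiv> set xs"

text \<open>On \<open>C\<close> the index is unique because \<open>xs\<close> is distinct; outside
  \<open>C\<close> the value is unspecified. The \<open>mod\<close> sends the last vertex to the
  first.\<close>

definition nxt :: "'a \<Rightarrow> 'a" where
  "nxt a = xs ! (Suc (THE i. i < length xs \<and> xs ! i = a) mod length xs)"

lemma C_subset_V: "C \<subseteq> V"
  using cyc_xs by (simp add: cyc_def)

lemma xs_nonempty: "xs \<noteq> []"
  using cyc_xs by (simp add: cyc_def)

lemma nxt_nth: "i < length xs \<Longrightarrow> nxt (xs ! i) = xs ! (Suc i mod length xs)"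
proof -
  assume i: "i < length xs"
  have "(THE j. j < length xs \<and> xs ! j = xs ! i) = i"
    using i cyc_xs by (auto simp: cyc_def nth_eq_iff_index_eq)
  then show ?thesis by (simp add: nxt_def)
qed

text \<open>Moves the wrap-around point to a chosen vertex, so that later arguments avoid modular
  indices. Rotating by \<open>Suc k\<close>, one past the position of \<open>v\<close>, puts
  \<open>v\<close> last.\<close>

lemma obtain_rotation:
  assumes "v \<in> C"
  obtains ys where "cyc ys" "set ys = C" "length ys = length xs" "last ys = v" "hd ys = nxt v"
    "\<And>i. Suc i < length ys \<Longrightarrow> nxt (ys ! i) = ys ! Suc i"
proof -
  obtain k where k: "k < length xs" "xs ! k = v"
    using assms by (auto simp: in_set_conv_nth)
  define ys where "ys = rotate (Suc k) xs"
  have n: "length xs > 0" using xs_nonempty by simp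
  have ne: "ys \<noteq> []" and len: "length ys = length xs" using xs_nonempty by (simp_all add: ys_def)
  have nth: "ys ! i = xs ! ((Suc k + i) mod length xs)" if "i < length xs" for i
    using that unfolding ys_def by (rule nth_rotate)
  have nx: "nxt (ys ! i) = ys ! Suc i" if "Suc i < length ys" for i
  proof -
    have "nxt (ys ! i) = xs ! (Suc ((Suc k + i) mod length xs) mod length xs)"
      using that n len by (simp only: nth nxt_nth mod_less_divisor Suc_lessD)
    also have "\<dots> = ys ! Suc i"
      using that len by (simp add: nth mod_Suc_eq)
    finally show ?thesis .
  qed
  have "last ys = xs ! ((Suc k + (length xs - 1)) mod length xs)"
    using n len ne by (simp add: last_conv_nth nth)
  also have "Suc k + (length xs - 1) = k + length xs" using n by simp
  finally have "last ys = v" using k by simp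
  moreover have "hd ys = nxt v"
    using n ne k by (simp add: hd_conv_nth nth flip: nxt_nth)
  ultimately show thesis
    using that[of ys] nx cyc_rotate[OF cyc_xs, of "Suc k"] len by (simp add: ys_def)
qed

lemma nxt_in_C: "v \<in> C \<Longrightarrow> nxt v \<in> C"
  using obtain_rotation by (metis cyc_def hd_in_set)

text \<open>With \<open>v\<close> placed last, \<open>nxt v\<close> has index 0, while every other
  vertex has a successor of positive index.\<close>

lemma inj_on_nxt: "inj_on nxt C"
proof (rule inj_onI)
  fix u v assume u: "u \<in> C" and v: "v \<in> C" and eq: "nxt u = nxt v"
  obtain ys where ys: "cyc ys" "set ys = C" "length ys = length xs" "last ys = v" "hd ys = nxt v"
    "\<And>i. Suc i < length ys \<Longrightarrow> nxt (ys ! i) = ys ! Suc i"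
    using obtain_rotation[OF v] by blast
  from u ys obtain i where i: "i < length ys" "ys ! i = u" by (metis in_set_conv_nth)
  have ne: "ys \<noteq> []" "distinct ys" using ys by (auto simp: cyc_def)
  have "\<not> Suc i < length ys"
  proof
    assume *: "Suc i < length ys"
    then have "ys ! Suc i = ys ! 0" using ys(5) ys(6)[of i] i eq ne by (simp add: hd_conv_nth)
    then show False using * ne by (simp add: nth_eq_iff_index_eq)
  qed
  then have "i = length ys - 1" using i by simp
  then show "u = v" using i ys(4) ne by (simp add: last_conv_nth)
qed

text \<open>The segments are what remains of the cycle without the edges leaving \<open>a\<close>
  and \<open>b\<close>. Rotating \<open>b\<close> to the end performs one cut, splitting the list
  behind \<open>a\<close> the other.\<close>

lemma obtain_split:
  assumes "a \<in> C" "b \<in> C" "a \<noteq> b"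
  obtains X Y where "X \<noteq> []" "Y \<noteq> []" "cyc (X @ Y)" "set (X @ Y) = C" "length (X @ Y) = length xs"
    "last X = a" "hd Y = nxt a" "last Y = b" "hd X = nxt b"
proof -
  obtain ys where ys: "cyc ys" "set ys = C" "length ys = length xs" "last ys = b" "hd ys = nxt b"
    "\<And>i. Suc i < length ys \<Longrightarrow> nxt (ys ! i) = ys ! Suc i"
    using obtain_rotation[OF assms(2)] by blast
  from assms ys obtain i where i: "i < length ys" "ys ! i = a" by (metis in_set_conv_nth)
  have ne: "ys \<noteq> []" using i by auto
  have "i \<noteq> length ys - 1" using i assms(3) ys(4) ne by (auto simp: last_conv_nth)
  then have si: "Suc i < length ys" using i by simp
  have "last (take (Suc i) ys) = a" using i by (simp add: take_Suc_conv_app_nth)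
  moreover have "hd (drop (Suc i) ys) = nxt a" using si i ys(6)[of i] by (simp add: hd_drop_conv_nth)
  moreover have "last (drop (Suc i) ys) = b" using si ys(4) by simp
  moreover have "hd (take (Suc i) ys) = nxt b" using ys(5) ne by (simp add: hd_take)
  ultimately show thesis
    using that[of "take (Suc i) ys" "drop (Suc i) ys"] si ys by (simp add: ne)
qed

section \<open>Reroutings that would lengthen the cycle\<close>

lemma nxt_adj_detour:
  assumes "a \<in> C" "hs \<noteq> []" "distinct hs" "set hs \<subseteq> V - C" "successively E hs"
    "E a (hd hs)" "E (last hs) (nxt a)"
  shows False
proof -
  obtain ys where ys: "cyc ys" "set ys = C" "length ys = length xs" "last ys = a" "hd ys = nxt a"
    using obtain_rotation[OF assms(1)] by blast
  then have "cyc (ys @ hs)"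
    using assms by (auto simp: cyc_def successively_append_iff)
  from longest[OF this] show False using ys(3) assms(2) by simp
qed

text \<open>The longer cycle runs backwards along \<open>X\<close> from \<open>a\<close> to
  \<open>nxt b\<close>, crosses to \<open>nxt a\<close> by the chord or through \<open>y\<close>,
  follows \<open>Y\<close> to \<open>b\<close> and returns to \<open>a\<close> through
  \<open>hs\<close>.\<close>

lemma nxt_nxt_detour:
  assumes "a \<in> C" "b \<in> C" "a \<noteq> b" "hs \<noteq> []" "distinct hs" "set hs \<subseteq> V - C" "successively E hs"
    "E b (hd hs)" "E (last hs) a"
  shows "\<not> E (nxt a) (nxt b)"
    and "y \<in> V - C - set hs \<Longrightarrow> E y (nxt a) \<Longrightarrow> \<not> E y (nxt b)"
proof -
  obtain X Y where XY: "X \<noteq> []" "Y \<noteq> []" "cyc (X @ Y)" "set (X @ Y) = C" "length (X @ Y) = length xs"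
    "last X = a" "hd Y = nxt a" "last Y = b" "hd X = nxt b"
    using obtain_split[OF assms(1-3)] by blast
  show "\<not> E (nxt a) (nxt b)"
  proof
    assume "E (nxt a) (nxt b)"
    then have "E (hd X) (hd Y)" using XY adj_sym by simp
    then have "cyc (rev X @ Y @ hs)"
      using assms XY by (auto simp: cyc_def successively_append_iff last_rev hd_rev hd_append)
    from longest[OF this] show False using XY(5) assms(4) by (simp flip: length_greater_0_conv)
  qed
  show "\<not> E y (nxt b)" if y: "y \<in> V - C - set hs" "E y (nxt a)"
  proof
    assume "E y (nxt b)"
    then have "E (hd X) y" "E y (hd Y)" using XY y adj_sym by simp_all
    then have "cyc (rev X @ y # Y @ hs)"
      using assms XY y by (auto simp: cyc_def successively_append_iff successively_Cons last_rev hd_rev hd_append)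
    from longest[OF this] show False using XY(5) assms(4) by (simp flip: length_greater_0_conv)
  qed
qed

text \<open>The longer cycle goes from \<open>h\<close> to position \<open>p\<close>, back to the
  head, by a chord to \<open>Suc q\<close>, on to the last vertex, by the other chord to
  \<open>Suc p\<close>, and forward to \<open>q\<close> and \<open>h\<close>.\<close>

lemma crossing_detour:
  assumes "cyc ys" "set ys = C" "length ys = length xs" "p < q" "Suc q < length ys"
    "h \<in> V - C" "E h (ys ! p)" "E h (ys ! q)" "E (hd ys) (ys ! Suc q)" "E (last ys) (ys ! Suc p)"
  shows False
proof -
  define X Y Z where "X = take (Suc p) ys" and "Y = drop (Suc p) (take (Suc q) ys)"
    and "Z = drop (Suc q) ys"
  have ys: "ys = X @ Y @ Z"
  proof -
    have "X = take (Suc p) (take (Suc q) ys)" using assms(4) by (simp add: X_def min_def)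
    then have "X @ Y = take (Suc q) ys" unfolding Y_def by (simp only: append_take_drop_id)
    then show ?thesis unfolding Z_def by (metis append_assoc append_take_drop_id)
  qed
  have ne: "X \<noteq> []" "Y \<noteq> []" "Z \<noteq> []"
    using assms(4,5) by (auto simp: X_def Y_def Z_def)
  have ends: "last X = ys ! p" "hd Y = ys ! Suc p" "last Y = ys ! q" "hd Z = ys ! Suc q"
    using assms(4,5)
    by (simp_all add: X_def Y_def Z_def hd_drop_conv_nth take_Suc_conv_app_nth[of p])
      (simp add: take_Suc_conv_app_nth)
  have "hd X = hd ys" "last Z = last ys" using ys ne by simp_all
  then have *: "E h (last X)" "E (last Y) h" "E (hd X) (hd Z)" "E (last Z) (hd Y)"
    using assms(7-10) ends adj_sym by simp_all
  have "cyc (h # rev X @ Z @ Y)"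
    using * ne assms(1,2,6) unfolding ys
    by (auto simp: cyc_def successively_append_iff successively_Cons last_rev hd_rev hd_append)
  from longest[OF this] show False using assms(3) by (simp add: ys)
qed

end


section \<open>Toughness and forbidden subgraphs\<close>

text \<open>\<open>card_separator\<close> is 3-toughness for a deletion leaving at least two
  components, whence the 6; \<open>card_independent\<close> comes from deleting all vertices outside
  \<open>U\<close>.\<close>

locale tough_free_adjacency = finite_adjacency +
  assumes card_separator: "\<lbrakk>K \<subseteq> V; K \<noteq> {}; V - K - nbrs K \<noteq> {}\<rbrakk> \<Longrightarrow> 6 \<le> card (nbrs K)"
    and card_independent: "\<lbrakk>U \<subseteq> V; 2 \<le> card U; \<And>u v. \<lbrakk>u \<in> U; v \<in> U\<rbrakk> \<Longrightarrow> \<not> E u v\<rbrakk> \<Longrightarrow> card U \<le> card (V - U)"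
    and no_edge_3_isolated: "\<lbrakk>E a b; T \<subseteq> V - {a, b}; card T = 3\<rbrakk>
      \<Longrightarrow> \<exists>x\<in>T. E a x \<or> E b x \<or> (\<exists>y\<in>T. E x y)"
begin

text \<open>Three vertices of \<open>T\<close> together with the edge \<open>a b\<close> would
  induce the forbidden subgraph.\<close>

lemma card_common_nonnbrs:
  assumes "E a b" "T \<subseteq> V - {a, b}" "\<And>x. x \<in> T \<Longrightarrow> \<not> E a x \<and> \<not> E b x"
    "\<And>x y. \<lbrakk>x \<in> T; y \<in> T\<rbrakk> \<Longrightarrow> \<not> E x y"
  shows "card T \<le> 2"
proof (rule ccontr)
  assume "\<not> card T \<le> 2"
  then obtain T' where "T' \<subseteq> T" "card T' = 3"
    using obtain_subset_with_card_n[of 3 T] by auto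
  then show False using no_edge_3_isolated[of a b T'] assms by blast
qed

end

section \<open>Vertices off the longest cycle\<close>

locale tough_free_longest_cycle = longest_cycle + tough_free_adjacency
begin

text \<open>A path through \<open>K\<close> joins any two attachment vertices, so the detours apply.
  Assuming \<open>linked\<close> covers both a component off the cycle and a single vertex.\<close>

lemma attachment_successors:
  assumes K: "K \<subseteq> V - C" "K \<noteq> {}" "nbrs K \<subseteq> C"
    and linked: "\<And>u v. \<lbrakk>u \<in> K; v \<in> K\<rbrakk> \<Longrightarrow>
      \<exists>hs. hs \<noteq> [] \<and> distinct hs \<and> set hs \<subseteq> K \<and> successively E hs \<and> hd hs = u \<and> last hs = v"
  shows "nxt ` nbrs K \<inter> nbrs K = {}"
    and "\<lbrakk>a \<in> nbrs K; b \<in> nbrs K\<rbrakk> \<Longrightarrow> \<not> E (nxt a) (nxt b)"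
    and "6 \<le> card (nbrs K)"
proof -
  have path: "\<exists>hs. hs \<noteq> [] \<and> distinct hs \<and> set hs \<subseteq> V - C \<and> successively E hs \<and> E a (hd hs) \<and> E (last hs) b"
    if ab: "a \<in> nbrs K" "b \<in> nbrs K" for a b
  proof -
    obtain u v where uv: "u \<in> K" "v \<in> K" "E u a" "E v b"
      using ab by (auto simp: nbrs_def)
    then obtain hs where "hs \<noteq> []" "distinct hs" "set hs \<subseteq> K" "successively E hs" "hd hs = u" "last hs = v"
      using linked by meson
    with uv K(1) adj_sym show ?thesis by (intro exI[of _ hs]) auto
  qed
  show disj: "nxt ` nbrs K \<inter> nbrs K = {}"
  proof (rule ccontr)
    assume "nxt ` nbrs K \<inter> nbrs K \<noteq> {}"
    then obtain a where a: "a \<in> nbrs K" "nxt a \<in> nbrs K" by auto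
    from path[OF a] a K(3) nxt_adj_detour[of a] show False by blast
  qed
  show "\<not> E (nxt a) (nxt b)" if ab: "a \<in> nbrs K" "b \<in> nbrs K"
  proof (cases "a = b")
    case False
    with path[OF ab(2,1)] ab K(3) nxt_nxt_detour(1)[of a b] show ?thesis by blast
  qed (simp add: adj_irrefl)
  show "6 \<le> card (nbrs K)"
  proof (rule card_separator)
    \<comment> \<open>\<open>nbrs K\<close> must separate \<open>K\<close> from something: from the
      successor of an attachment vertex, by \<open>disj\<close>, or from any cycle vertex if there
      is no attachment.\<close>
    obtain c where c: "c \<in> C" "c \<notin> nbrs K"
    proof (cases "nbrs K = {}")
      case True
      then show ?thesis using that xs_nonempty by fastforce
    next
      case False
      then obtain a where "a \<in> nbrs K" by blast
      then show ?thesis using that[of "nxt a"] disj nxt_in_C K(3) by blast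
    qed
    then show "V - K - nbrs K \<noteq> {}" using K(1) C_subset_V by blast
  qed (use K in auto)
qed

lemma off_cycle_independent:
  assumes "u \<in> V - C" "v \<in> V - C"
  shows "\<not> E u v"
proof
  assume uv: "E u v"
  \<comment> \<open>\<open>R\<close> is adjacency off the cycle, and \<open>K\<close> the component
    of \<open>u\<close> in it.\<close>
  define R where "R = {(x, y). E x y \<and> x \<in> V - C \<and> y \<in> V - C}"
  define K where "K = {x. (u, x) \<in> R\<^sup>*}"
  have "sym R" by (auto simp: R_def sym_def adj_sym)
  have in_off: "y \<in> V - C" if "(x, y) \<in> R\<^sup>*" "x \<in> V - C" for x y
    using that by (induction rule: rtrancl_induct) (auto simp: R_def)
  have K_sub: "K \<subseteq> V - C" using in_off assms(1) by (auto simp: K_def)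
  have u: "u \<in> K" by (simp add: K_def)
  have v: "v \<in> K" using uv assms by (auto simp: K_def R_def)
  have K_step: "y \<in> K" if "x \<in> K" "(x, y) \<in> R" for x y
    using that by (auto simp: K_def intro: rtrancl_into_rtrancl)
  have K_nbrs: "nbrs K \<subseteq> C"
    using K_step K_sub by (auto simp: nbrs_def R_def)
  have linked: "\<exists>hs. hs \<noteq> [] \<and> distinct hs \<and> set hs \<subseteq> K \<and> successively E hs \<and> hd hs = x \<and> last hs = y"
    if xy: "x \<in> K" "y \<in> K" for x y
  proof -
    have "(x, u) \<in> R\<^sup>*" using xy(1) \<open>sym R\<close> by (auto simp: K_def dest: sym_rtrancl symD)
    then have "(x, y) \<in> R\<^sup>*" using xy(2) by (auto simp: K_def)
    \<comment> \<open>The walk from \<open>x\<close> never leaves \<open>K\<close>, so it can be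
      shortened to a path inside \<open>K\<close>.\<close>
    then have "(x, y) \<in> {(x, y). E x y \<and> x \<in> K \<and> y \<in> K}\<^sup>*"
    proof (induction rule: rtrancl_induct)
      case (step y z)
      have "y \<in> K" using step.hyps(1) xy(1) by (auto simp: K_def)
      then show ?case using step K_step[of y z] by (auto simp: R_def intro: rtrancl_into_rtrancl)
    qed simp
    then obtain hs where "hs \<noteq> []" "distinct hs" "set hs \<subseteq> K" "successively E hs" "hd hs = x" "last hs = y"
      using xy(1) by (rule obtain_path_inside)
    then show ?thesis by blast
  qed
  note succ = attachment_successors[OF K_sub _ K_nbrs linked]
  have "card (nxt ` nbrs K) = card (nbrs K)"
    using K_nbrs by (meson card_image inj_on_nxt inj_on_subset)
  moreover have "card (nxt ` nbrs K) \<le> 2"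
  proof (rule card_common_nonnbrs[OF uv])
    have "nxt ` nbrs K \<subseteq> C" using K_nbrs nxt_in_C by blast
    then show "nxt ` nbrs K \<subseteq> V - {u, v}" using assms C_subset_V by blast
    show "\<not> E u x \<and> \<not> E v x" if "x \<in> nxt ` nbrs K" for x
    proof -
      have "x \<notin> nbrs K" "x \<in> V - K" using succ(1) u that K_sub K_nbrs nxt_in_C C_subset_V by blast+
      then show ?thesis using u v by (auto simp: nbrs_def)
    qed
    show "\<not> E x y" if "x \<in> nxt ` nbrs K" "y \<in> nxt ` nbrs K" for x y
      using succ(2) u that by blast
  qed
  moreover have "6 \<le> card (nbrs K)" using succ(3) u by blast
  ultimately show False by simp
qed

lemma spanning: "V \<subseteq> C"
proof (rule ccontr)
  assume "\<not> V \<subseteq> C"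
  then obtain h where h: "h \<in> V - C" by blast
  define A where "A = nbrs {h}"
  have A_iff: "a \<in> A \<longleftrightarrow> E h a" for a
    using adj_irrefl adj_in_V2 by (auto simp: A_def nbrs_def)
  have A_C: "A \<subseteq> C" using off_cycle_independent[OF h] adj_in_V2 unfolding A_iff[abs_def] subset_iff by blast
  have "\<exists>hs. hs \<noteq> [] \<and> distinct hs \<and> set hs \<subseteq> {h} \<and> successively E hs \<and> hd hs = u \<and> last hs = v"
    if "u \<in> {h}" "v \<in> {h}" for u v
    using that by (intro exI[of _ "[h]"]) simp
  \<comment> \<open>The single vertex \<open>h\<close> is linked by a one-vertex path; its
    attachment vertices are its neighbours \<open>A\<close>.\<close>
  note succ = attachment_successors[of "{h}", folded A_def, OF _ _ A_C this]
  have succ_disj: "nxt ` A \<inter> A = {}" and succ_indep: "\<And>a b. \<lbrakk>a \<in> A; b \<in> A\<rbrakk> \<Longrightarrow> \<not> E (nxt a) (nxt b)"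
    and card_A: "6 \<le> card A"
    using succ h by blast+
  define J where "J = insert h (nxt ` A)"
  have nxtA_C: "nxt ` A \<subseteq> C" using A_C nxt_in_C by blast
  have J_V: "J \<subseteq> V" using h nxtA_C C_subset_V by (auto simp: J_def)
  have fin: "finite A" "finite J" using A_C J_V finite_V by (auto intro: finite_subset)
  have card_nxtA: "card (nxt ` A) = card A"
    using A_C by (meson card_image inj_on_nxt inj_on_subset)
  have h_nxtA: "h \<notin> nxt ` A" using h nxtA_C by blast
  have card_J: "card J = Suc (card A)" using fin h_nxtA card_nxtA by (simp add: J_def)
  have J_indep: "\<not> E x y" if "x \<in> J" "y \<in> J" for x y
  proof -
    have "\<not> E h z" if "z \<in> nxt ` A" for z using that succ_disj by (auto simp: A_iff)
    then show ?thesis using that succ_indep adj_irrefl adj_sym unfolding J_def by blast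
  qed
  define D where "D = {v \<in> V. \<exists>x\<in>J. E v x}"
  have D_J: "D \<inter> J = {}" using J_indep by (auto simp: D_def)
  \<comment> \<open>\<open>v\<close> has a neighbour \<open>x\<close> in \<open>J\<close>, and
    \<open>x\<close> is adjacent to nothing in \<open>J\<close>; so the vertices of \<open>J\<close>
    missed by \<open>v\<close> are missed by the whole edge \<open>v x\<close>.\<close>
  have misses: "card {x \<in> J. \<not> E v x} \<le> 2" if "v \<in> D" for v
  proof -
    from that obtain x where x: "x \<in> J" "E v x" by (auto simp: D_def)
    show ?thesis
      by (rule card_common_nonnbrs[OF x(2)]) (use x J_indep J_V D_J that in auto)
  qed
  have D_C: "D \<subseteq> C"
  proof (rule ccontr)
    assume "\<not> D \<subseteq> C"
    then obtain y where y: "y \<in> D" "y \<in> V - C" by (auto simp: D_def)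
    have "\<not> E y h" using off_cycle_independent y(2) h by blast
    then obtain a where a: "a \<in> A" "E y (nxt a)" using y(1) by (auto simp: D_def J_def)
    have "h \<noteq> nxt a" using a h_nxtA by blast
    \<comment> \<open>\<open>J\<close> has at least five vertices besides \<open>h\<close> and
      \<open>nxt a\<close>, and \<open>y\<close> misses at most two. So \<open>y\<close> sees a
      second successor \<open>nxt b\<close>, and both \<open>y\<close> and \<open>h\<close> fit into
      a longer cycle.\<close>
    then have "card (J - {h, nxt a}) = card J - 2"
      using a by (subst card_Diff_subset) (auto simp: J_def)
    then have "\<not> J - {h, nxt a} \<subseteq> {x \<in> J. \<not> E y x}"
      using misses[OF y(1)] card_J card_A fin card_mono[of "{x \<in> J. \<not> E y x}" "J - {h, nxt a}"] by auto
    then obtain b where b: "b \<in> A" "nxt b \<noteq> nxt a" "E y (nxt b)" by (auto simp: J_def)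
    then have "a \<noteq> b" by blast
    moreover have "y \<noteq> h" using D_J y(1) by (auto simp: J_def)
    ultimately show False
      using nxt_nxt_detour(2)[of a b "[h]" y] a b subsetD[OF A_C] y(2) h adj_sym by (simp add: A_iff)
  qed
  have nxt_D: "nxt v \<notin> D" if v: "v \<in> D" for v
  proof
    assume w: "nxt v \<in> D"
    obtain ys where ys: "cyc ys" "set ys = C" "length ys = length xs" "last ys = v" "hd ys = nxt v"
      "\<And>i. Suc i < length ys \<Longrightarrow> nxt (ys ! i) = ys ! Suc i"
      using obtain_rotation v D_C by blast
    have dist: "distinct ys" "ys \<noteq> []" using ys(1) by (auto simp: cyc_def)
    \<comment> \<open>\<open>ys\<close> is now a path through \<open>C\<close> from
      \<open>nxt v\<close> to \<open>v\<close>, and \<open>Q\<close> holds the positions of the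
      neighbours of \<open>h\<close>.\<close>
    define Q where "Q = {i. i < length ys \<and> ys ! i \<in> A}"
    have "A = (!) ys ` Q"
    proof
      show "A \<subseteq> (!) ys ` Q"
      proof
        fix a assume a: "a \<in> A"
        then have "a \<in> set ys" using A_C ys(2) by blast
        then show "a \<in> (!) ys ` Q" using a by (auto simp: Q_def in_set_conv_nth)
      qed
    qed (auto simp: Q_def)
    moreover have "inj_on ((!) ys) Q"
      using dist(1) by (auto simp: Q_def inj_on_def nth_eq_iff_index_eq)
    ultimately have "card A = card Q" by (simp add: card_image)
    \<comment> \<open>The last position is not in \<open>Q\<close>: if \<open>v\<close> were in
      \<open>A\<close>, then \<open>nxt v\<close> would lie in both \<open>J\<close> and
      \<open>D\<close>.\<close>
    have Q_Suc: "Suc i < length ys" if "i \<in> Q" for i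
    proof (rule ccontr)
      assume "\<not> Suc i < length ys"
      with that have "i = length ys - 1" by (auto simp: Q_def)
      then have "v \<in> A" using that ys(4) dist by (simp add: Q_def last_conv_nth)
      then show False using w D_J by (auto simp: J_def)
    qed
    define B where "B u = {i \<in> Q. \<not> E u (ys ! Suc i)}" for u
    have fin_Q: "finite Q" by (simp add: Q_def)
    have card_B: "card (B u) \<le> 2" if "u \<in> D" for u
    proof -
      \<comment> \<open>Passing from a position in \<open>Q\<close> to the vertex after it lands in
        \<open>J\<close>, so \<open>misses\<close> bounds \<open>B u\<close>.\<close>
      have "(\<lambda>i. ys ! Suc i) ` B u \<subseteq> {x \<in> J. \<not> E u x}"
      proof -
        have "ys ! Suc i \<in> J" if "i \<in> Q" for i
          using that ys(6)[OF Q_Suc[OF that], symmetric] by (simp add: Q_def J_def)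
        then show ?thesis by (auto simp: B_def)
      qed
      moreover have "inj_on (\<lambda>i. ys ! Suc i) (B u)"
        using dist(1) Q_Suc by (auto simp: B_def inj_on_def nth_eq_iff_index_eq)
      ultimately have "card (B u) \<le> card {x \<in> J. \<not> E u x}"
        using fin(2) by (intro card_inj_on_le) auto
      with misses[OF that] show ?thesis by simp
    qed
    have "Q - B v \<noteq> {}"
    proof
      assume "Q - B v = {}"
      then have "Q = B v" by (auto simp: B_def)
      with card_B[OF v] \<open>card A = card Q\<close> card_A show False by simp
    qed
    \<comment> \<open>With \<open>p\<close> least, any other position of \<open>Q\<close> outside
      \<open>B v\<close> lies beyond it, as the order in \<open>crossing_detour\<close>
      requires.\<close>
    define p where "p = Min (Q - B v)"
    have p: "p \<in> Q - B v"
      unfolding p_def by (rule Min_in) (use fin_Q \<open>Q - B v \<noteq> {}\<close> in auto)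
    have p_le: "p \<le> i" if "i \<in> Q - B v" for i
      unfolding p_def by (rule Min_le) (use fin_Q that in auto)
    \<comment> \<open>A position of \<open>Q\<close> below \<open>p\<close> lies in \<open>B v\<close>; were there no crossing pair, those above \<open>p\<close> would lie in \<open>B (nxt v)\<close>.\<close>
    have "\<not> Q \<subseteq> B v \<union> B (nxt v) \<union> {p}"
    proof
      assume "Q \<subseteq> B v \<union> B (nxt v) \<union> {p}"
      then have "card Q \<le> card (B v \<union> B (nxt v) \<union> {p})"
        using fin_Q by (intro card_mono) (auto simp: B_def)
      also have "\<dots> \<le> card (B v) + card (B (nxt v)) + 1"
        using card_Un_le[of "B v \<union> B (nxt v)" "{p}"] card_Un_le[of "B v" "B (nxt v)"] by simp
      finally show False using card_B[OF v] card_B[OF w] card_A \<open>card A = card Q\<close> by simp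
    qed
    then obtain q where q: "q \<in> Q" "q \<notin> B v" "q \<notin> B (nxt v)" "q \<noteq> p" by blast
    have "p < q" using p_le[of q] q by auto
    then show False
      using crossing_detour[OF ys(1-3), of p q h] p q Q_Suc h ys(4,5)
      by (auto simp: Q_def B_def A_iff)
  qed
  have "card (V - D) \<le> card (V - (V - D))"
  proof (rule card_independent)
    have "J \<subseteq> V - D" using J_V D_J by blast
    then have "card J \<le> card (V - D)" using finite_V by (intro card_mono) auto
    then show "2 \<le> card (V - D)" using card_J card_A by simp
    show "\<not> E u v" if uv: "u \<in> V - D" "v \<in> V - D" for u v
    proof
      assume E: "E u v"
      then have "u \<notin> J" "v \<notin> J" using uv adj_sym by (auto simp: D_def)
      \<comment> \<open>No vertex outside \<open>D\<close> has a neighbour in \<open>J\<close>, so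
        all of \<open>J\<close> avoids the edge \<open>u v\<close>.\<close>
      then have "card J \<le> 2"
        using uv J_V J_indep by (intro card_common_nonnbrs[OF E]) (auto simp: D_def)
      then show False using card_J card_A by simp
    qed
  qed simp
  moreover have "V - (V - D) = D" by (auto simp: D_def)
  \<comment> \<open>\<open>nxt\<close> injects \<open>D\<close> into \<open>V - D\<close> and misses
    \<open>h\<close>, which is off the cycle.\<close>
  moreover have "card D < card (V - D)"
  proof -
    have "nxt ` D \<subseteq> C" using nxt_in_C D_C by blast
    moreover have "nxt ` D \<inter> D = {}" using nxt_D by blast
    ultimately have "nxt ` D \<subset> V - D" using D_C C_subset_V h by blast
    then have "card (nxt ` D) < card (V - D)"
      using finite_V by (intro psubset_card_mono) auto
    then show ?thesis
      using card_image[OF inj_on_subset[OF inj_on_nxt D_C]] by simp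
  qed
  ultimately show False by simp
qed

end

section \<open>Existence of a longest cycle\<close>

theorem (in tough_free_adjacency) obtain_hamiltonian_cyc:
  assumes "2 \<le> card V"
  obtains xs where "cyc xs" "set xs = V"
proof -
  obtain x where x: "x \<in> V" using assms by fastforce
  \<comment> \<open>An isolated vertex would be separated from the rest by the empty set.\<close>
  have "\<exists>y. E x y"
  proof (rule ccontr)
    assume "\<nexists>y. E x y"
    then have "nbrs {x} = {}" by (simp add: nbrs_def)
    moreover have "V - {x} \<noteq> {}"
      using assms card_mono[of "{x}" V] by auto
    ultimately show False using card_separator[of "{x}"] x by simp
  qed
  then obtain y where "E x y" by blast
  \<comment> \<open>A single edge is already a \<open>cyc\<close>, so the maximum of the lengths,
    bounded by \<open>card V\<close>, is taken over a nonempty family.\<close>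
  then have "cyc [x, y]"
    using adj_irrefl adj_in_V adj_in_V2 adj_sym by (auto simp: cyc_def)
  then obtain xs where "cyc xs" and "\<And>ys. cyc ys \<Longrightarrow> length ys \<le> length xs"
    using ex_has_greatest_nat[of cyc "[x, y]" length "Suc (card V)"] length_cyc_le
    by (metis le_imp_less_Suc)
  then interpret tough_free_longest_cycle V E xs
    by unfold_locales
  show thesis using that cyc_xs spanning C_subset_V by blast
qed

section \<open>Transfer to digraphs\<close>

lemma (in graph) reachable_invariant:
  assumes "\<And>u v. u \<rightarrow> v \<Longrightarrow> f u = f v" "u \<rightarrow>\<^sup>* v"
  shows "f u = f v"
proof -
  have "(u, v) \<in> (arcs_ends G)\<^sup>*" using assms(2) by (rule reachable_rtranclI)
  then show ?thesis by (induction rule: rtrancl_induct) (auto dest: assms(1))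
qed

text \<open>\<open>f\<close> is constant on each component, so every value appears at a chosen
  representative of some component. This bounds the number of components without listing
  them.\<close>

lemma (in graph) card_invariant_le_num_components:
  assumes "\<And>u v. u \<rightarrow> v \<Longrightarrow> f u = f v"
  shows "card (f ` verts G) \<le> num_components G"
proof -
  have "finite sccs" unfolding sccs_conv_sccs_verts using finite_sccs_verts by simp
  moreover have "f ` verts G \<subseteq> (\<lambda>c. f (SOME v. v \<in> verts c)) ` sccs"
  proof
    fix x assume "x \<in> f ` verts G"
    then obtain u where u: "u \<in> verts G" "x = f u" by blast
    have "u \<rightarrow>\<^sup>* (SOME v. u \<rightarrow>\<^sup>* v)" using u(1) by (intro someI[of "\<lambda>v. u \<rightarrow>\<^sup>* v" u]) (rule reachable_refl)
    then have "x = f (SOME v. v \<in> verts (G \<restriction> {v. u \<rightarrow>\<^sup>* v}))"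
      using reachable_invariant[of f, OF assms] u(2) by simp
    then show "x \<in> (\<lambda>c. f (SOME v. v \<in> verts c)) ` sccs"
      using induce_reachable_is_in_sccs[OF u(1)] by blast
  qed
  ultimately show ?thesis
    unfolding num_components_def components_eq_sccs by (rule surj_card_le)
qed

lemma (in graph) connected_invariant:
  assumes "Digraph_Component.connected G" "\<And>u v. u \<rightarrow> v \<Longrightarrow> f u = f v"
    "u \<in> verts G" "v \<in> verts G"
  shows "f u = f v"
proof -
  have "strongly_connected G"
    using assms(1) sym_arcs by (intro symmetric_connected_imp_strongly_connected)
  then have "u \<rightarrow>\<^sup>* v" using assms(3,4) by (auto simp: strongly_connected_def)
  with assms(2) show ?thesis by (rule reachable_invariant)
qed

text \<open>A labelling constant along the arcs of \<open>G - S\<close> certifies by two values that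
  \<open>S\<close> is a cut set, and bounds the number of components from below.\<close>

lemma (in graph) tough_card_invariant:
  assumes "tough t G" "0 \<le> t" "S \<subseteq> verts G"
    and f: "\<And>u v. \<lbrakk>u \<rightarrow> v; u \<notin> S; v \<notin> S\<rbrakk> \<Longrightarrow> f u = f v"
    and two: "2 \<le> card (f ` (verts G - S))"
  shows "t * real (card (f ` (verts G - S))) \<le> real (card S)"
proof -
  interpret H: graph "del_verts G S"
  proof -
    have ind: "induced_subgraph (del_verts G S) G"
      unfolding del_verts_def by (rule induced_induce) simp
    interpret H: digraph "del_verts G S" using ind by (rule digraphI_induced)
    show "graph (del_verts G S)"
      using induced_graph_imp_symmetric[OF sym_arcs ind] by unfold_locales
  qed
  have f': "f u = f v" if "u \<rightarrow>\<^bsub>del_verts G S\<^esub> v" for u v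
    using that f unfolding del_verts_def by (auto simp: arcs_ends_conv)
  have verts: "verts (del_verts G S) = verts G - S" by (simp add: del_verts_def)
  have "\<not> Digraph_Component.connected (del_verts G S)"
  proof
    assume "Digraph_Component.connected (del_verts G S)"
    then have "f u = f v" if "u \<in> verts G - S" "v \<in> verts G - S" for u v
      using H.connected_invariant[of f] f' that verts by blast
    then have "\<forall>x\<in>f ` (verts G - S). \<forall>y\<in>f ` (verts G - S). x = y" by blast
    moreover have "finite (f ` (verts G - S))" by simp
    ultimately have "card (f ` (verts G - S)) \<le> Suc 0"
      using card_le_Suc0_iff_eq by blast
    with two show False by simp
  qed
  then have "t * real (num_components (del_verts G S)) \<le> real (card S)"
    using assms(1,3) by (simp add: tough_def cut_set_def)
  moreover have "card (f ` (verts G - S)) \<le> num_components (del_verts G S)"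
    using H.card_invariant_le_num_components[of f, OF f'] verts by simp
  ultimately show ?thesis
    using assms(2) by (meson mult_left_mono of_nat_mono order_trans)
qed

lemma (in graph) K2_3K1_induced:
  assumes free: "induced_free K2_3K1 G" and ab: "a \<rightarrow> b"
    and T: "T \<subseteq> verts G - {a, b}" "card T = 3"
  shows "\<exists>x\<in>T. a \<rightarrow> x \<or> b \<rightarrow> x \<or> (\<exists>y\<in>T. x \<rightarrow> y)"
proof (rule ccontr)
  assume none: "\<not> ?thesis"
  obtain x y z where xyz: "T = {x, y, z}" "x \<noteq> y" "y \<noteq> z" "x \<noteq> z"
    using T(2) by (auto simp: card_3_iff)
  define W where "W = {a, b, x, y, z}"
  have ne: "a \<noteq> b" using ab adj_not_same by blast
  have dist: "a \<noteq> x" "a \<noteq> y" "a \<noteq> z" "b \<noteq> x" "b \<noteq> y" "b \<noteq> z" using T(1) xyz(1) by auto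
  have ba: "b \<rightarrow> a" using ab by (rule arcs_ends_symmetric[OF sym_arcs])
  have W: "W \<subseteq> verts G" using ab T(1) xyz(1) by (auto simp: W_def)
  \<comment> \<open>Numbers the five vertices as in \<open>K2_3K1\<close>, with the edge
    \<open>a b\<close> at 0 and 1; \<open>g\<close> replaces each arc by the numbers of its
    ends.\<close>
  define f :: "'a \<Rightarrow> nat" where
    "f v = (if v = a then 0 else if v = b then 1 else if v = x then 2 else if v = y then 3 else 4)" for v
  define g where "g e = (f (tail G e), f (head G e))" for e
  \<comment> \<open>\<open>none\<close> rules out arcs from \<open>a\<close> or \<open>b\<close>
    into \<open>T\<close> and arcs within \<open>T\<close>; symmetry rules out those leaving
    \<open>T\<close>.\<close>
  have ends: "(tail G e, head G e) \<in> {(a, b), (b, a)}" if "e \<in> arcs (G \<restriction> W)" for e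
  proof -
    let ?u = "tail G e" and ?v = "head G e"
    have e: "?u \<in> W" "?v \<in> W" "?u \<rightarrow> ?v" using that by (auto intro: in_arcs_imp_in_arcs_ends)
    have "?v \<rightarrow> ?u" using e(3) by (rule arcs_ends_symmetric[OF sym_arcs])
    moreover have W_eq: "w \<in> W \<longleftrightarrow> w = a \<or> w = b \<or> w \<in> T" for w by (auto simp: W_def xyz(1))
    ultimately have "?u \<notin> T" "?v \<notin> T" using e none unfolding W_eq by metis+
    moreover have "?u \<noteq> ?v" using e(3) adj_not_same by metis
    ultimately show ?thesis using e(1,2) unfolding W_eq by auto
  qed
  have "digraph_iso (G \<restriction> W) K2_3K1"
    unfolding digraph_iso_def
  proof (intro exI conjI)
    let ?hom = "\<lparr>iso_verts = f, iso_arcs = g, iso_head = snd, iso_tail = fst\<rparr>"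
    have "inj_on f W" using ne dist xyz by (auto simp: inj_on_def W_def f_def)
    moreover have "inj_on g (arcs (G \<restriction> W))"
    proof (rule inj_onI)
      fix e e' assume e: "e \<in> arcs (G \<restriction> W)" "e' \<in> arcs (G \<restriction> W)" "g e = g e'"
      \<comment> \<open>By \<open>ends\<close> the label determines both ends, and parallel arcs do
        not exist.\<close>
      then have "arc_to_ends G e = arc_to_ends G e'"
        using ends[OF e(1)] ends[OF e(2)] ne by (auto simp: g_def f_def arc_to_ends_def)
      then show "e = e'" using e no_multi_arcs by simp
    qed
    ultimately show "pre_digraph.digraph_isomorphism (G \<restriction> W) ?hom"
      by (auto simp: pre_digraph.digraph_isomorphism_def g_def)
    obtain e e' where e: "e \<in> arcs G" "tail G e = a" "head G e = b"
      "e' \<in> arcs G" "tail G e' = b" "head G e' = a"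
      using ab ba by (auto simp: arcs_ends_conv)
    have "g ` arcs (G \<restriction> W) = {(0, 1), (1, 0)}"
    proof
      show "g ` arcs (G \<restriction> W) \<subseteq> {(0, 1), (1, 0)}"
      proof
        fix q assume "q \<in> g ` arcs (G \<restriction> W)"
        then obtain e where e: "e \<in> arcs (G \<restriction> W)" "q = g e" by blast
        then show "q \<in> {(0, 1), (1, 0)}" using ends[OF e(1)] ne by (auto simp: g_def f_def)
      qed
      have "g e = (0, 1)" "g e' = (1, 0)" using e ne by (simp_all add: g_def f_def)
      moreover have "e \<in> arcs (G \<restriction> W)" "e' \<in> arcs (G \<restriction> W)" using e by (simp_all add: W_def)
      ultimately show "{(0, 1), (1, 0)} \<subseteq> g ` arcs (G \<restriction> W)" by force
    qed
    moreover have "f ` W = {0, 1, 2, 3, 4}" using ne dist xyz by (auto simp: W_def f_def)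
    ultimately show "K2_3K1 = app_iso ?hom (G \<restriction> W)"
      by (simp add: app_iso_def K2_3K1_def with_proj_def)
  qed
  moreover have "induced_subgraph (G \<restriction> W) G" using W by (rule induced_induce)
  ultimately show False using free by (auto simp: induced_free_def)
qed

text \<open>Chooses an arc for each consecutive pair, turning vertex lists into the arc lists used
  by \<open>hamiltonian\<close>.\<close>

lemma (in wf_digraph) awalk_of_verts:
  assumes "u \<in> verts G" "successively (\<lambda>u v. u \<rightarrow> v) (u # us)"
  obtains p where "awalk u p (last (u # us))" "awalk_verts u p = u # us"
proof -
  have "\<exists>p. awalk u p (last (u # us)) \<and> awalk_verts u p = u # us"
    using assms
  proof (induction us arbitrary: u)
    case Nil
    then show ?case by (intro exI[of _ "[]"]) (simp add: awalk_Nil_iff)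
  next
    case (Cons v us)
    then obtain p where "awalk v p (last (v # us))" "awalk_verts v p = v # us"
      by (auto dest: adj_in_verts)
    moreover obtain e where "e \<in> arcs G" "tail G e = u" "head G e = v"
      using Cons.prems by (auto simp: arcs_ends_conv)
    ultimately show ?case using Cons.prems(1)
      by (intro exI[of _ "e # p"]) (auto simp: awalk_Cons_iff)
  qed
  with that show ?thesis by blast
qed

theorem theorem1p1:
  fixes G :: "('a,'b) pre_digraph"
  assumes "graph G"
    and "card (verts G) \<ge> 3"
    and "tough 3 G"
    and "induced_free K2_3K1 G"
  shows "hamiltonian G"
proof -
  interpret graph G by fact
  interpret adj: finite_adjacency "verts G" "\<lambda>u v. u \<rightarrow>\<^bsub>G\<^esub> v"
    by unfold_locales (auto intro: arcs_ends_symmetric[OF sym_arcs] dest: adj_not_same)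
  interpret adj: tough_free_adjacency "verts G" "\<lambda>u v. u \<rightarrow>\<^bsub>G\<^esub> v"
  proof unfold_locales
    fix K assume K: "K \<subseteq> verts G" "K \<noteq> {}" "verts G - K - adj.nbrs K \<noteq> {}"
    \<comment> \<open>Membership in \<open>K\<close> is the labelling: once \<open>nbrs K\<close> is
      deleted it is constant along arcs and takes both values.\<close>
    have "(\<lambda>v. v \<in> K) ` (verts G - adj.nbrs K) = {True, False}"
      using K by (auto simp: adj.nbrs_def image_iff)
    moreover have "u \<in> K \<longleftrightarrow> v \<in> K" if "u \<rightarrow>\<^bsub>G\<^esub> v" "u \<notin> adj.nbrs K" "v \<notin> adj.nbrs K" for u v
      using that adj.adj_sym adj.adj_in_V by (auto simp: adj.nbrs_def)
    ultimately show "6 \<le> card (adj.nbrs K)"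
      using tough_card_invariant[OF assms(3) _ adj.nbrs_subset_V, of K "\<lambda>v. v \<in> K"] by simp
  next
    fix U assume U: "U \<subseteq> verts G" "2 \<le> card U" "\<And>u v. \<lbrakk>u \<in> U; v \<in> U\<rbrakk> \<Longrightarrow> \<not> u \<rightarrow>\<^bsub>G\<^esub> v"
    \<comment> \<open>Deleting all but the independent set \<open>U\<close> leaves no arcs, so the
      identity is a valid labelling with \<open>card U\<close> values.\<close>
    have "verts G - (verts G - U) = U" using U(1) by blast
    then have "3 * real (card U) \<le> real (card (verts G - U))"
      using tough_card_invariant[OF assms(3), of "verts G - U" "\<lambda>v. v"] U adj.adj_in_V adj.adj_in_V2
      by auto
    then show "card U \<le> card (verts G - U)" by linarith
  qed (use K2_3K1_induced[OF assms(4)] in blast)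
  obtain xs where xs: "adj.cyc xs" "set xs = verts G"
    using adj.obtain_hamiltonian_cyc assms(2) by auto
  then obtain u us where us: "xs = u # us" by (auto simp: adj.cyc_def neq_Nil_conv)
  \<comment> \<open>Repeating \<open>u\<close> at the end closes the walk; its tails are then
    exactly \<open>xs\<close>.\<close>
  have "successively (\<lambda>u v. u \<rightarrow>\<^bsub>G\<^esub> v) (u # us @ [u])"
    using xs(1) unfolding us adj.cyc_def
    by (auto simp: successively_append_iff successively_Cons split: if_splits)
  then obtain p where p: "awalk u p u" "awalk_verts u p = u # us @ [u]"
    using awalk_of_verts[of u "us @ [u]"] xs(2) us by auto
  then have tails: "map (tail G) p = xs" by (auto simp: awalk_verts_conv us split: if_splits)
  have "length p = card (verts G)"
    using tails xs by (metis adj.cyc_def distinct_card length_map)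
  moreover have "tail G ` set p = verts G" using tails xs(2) by (metis set_map)
  moreover have "cycle p" using p xs(1) tails by (auto simp: cycle_def adj.cyc_def us)
  ultimately show ?thesis using assms(2) unfolding hamiltonian_def by auto
qed

end
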